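(* Let $n,k$ be positive integers and let $\mathscr{A}_n^k(x)=\sum_{w\in\{0,1,\dots,k-1\}^n}x^{asc(w)}$ be the $n$-th ascent polynomial for $k$-ary words, and let $(a,b)$ be its $\mathcal{I}_n$-decomposition. If $k>n$, then $\mathcal{I}_n(\mathscr{A}_n^k)\ll\mathscr{A}_n^k$ for $\deg(\mathscr{A}_n^k(x))=n$. In particular, $\mathscr{A}_n^k(x)$ is alternatingly increasing and $b\ll a$.
   Context: For a word $w=w_1\cdots w_n$ put $w_0=0$; $asc(w)$ is the number of $i\in\{0,1,\dots,n-1\}$ with $w_i<w_{i+1}$. For $p$ of degree at most $n$, $\mathcal{I}_n(p)(x)=x^np(1/x)$. The $\mathcal{I}_n$-decomposition of $p$ is the unique pair $(a,b)$ with $p=a+xb$, $\mathcal{I}_n(a)=a$ and $\mathcal{I}_{n-1}(b)=b$. For real-rooted real polynomials $f,g$ with zeros $\{r_i\}$, $\{s_j\}$ in decreasing order, $g\preceq f$ means either $\deg f=\deg g+1=d$ and $r_d\le s_{d-1}\le\cdots\le s_1\le r_1$, or $\deg f=\deg g=d$ and $s_d\le r_d\le\cdots\le s_1\le r_1$; $g\ll f$ means $g\preceq f$ with leading coefficients of the same sign, or $f\preceq g$ with leading coefficients of opposite sign; by convention $0\ll f$ and $f\ll0$ for real-rooted $f$. A polynomial $p=\sum_{j=0}^np_jx^j$ of degree $n$ is alternatingly increasing if $0\le p_0\le p_n\le p_1\le p_{n-1}\le\cdots\le p_{\lfloor(n+1)/2\rfloor}$. *)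

theory Defs
  imports "HOL-Computational_Algebra.Computational_Algebra" Complex_Main
begin

definition kwords :: "nat \<Rightarrow> nat \<Rightarrow> nat list set" where
  "kwords n k = {w. length w = n \<and> set w \<subseteq> {0..<k}}"

text \<open>The letter \<open>w\<^sub>0 = 0\<close> is prepended, so that \<open>(0 # w) ! i = w\<^sub>i\<close>.\<close>

definition asc :: "nat list \<Rightarrow> nat" where
  "asc w = card {i \<in> {0..<length w}. (0 # w) ! i < (0 # w) ! (i + 1)}"

definition ascent_poly :: "nat \<Rightarrow> nat \<Rightarrow> real poly" where
  "ascent_poly n k = (\<Sum>w\<in>kwords n k. monom 1 (asc w))"

text \<open>\<open>x\<^sup>n p(1/x)\<close> as a polynomial; only meant for \<open>degree p \<le> n\<close>, see \<open>poly_recip\<close> below.\<close>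

definition recip :: "nat \<Rightarrow> real poly \<Rightarrow> real poly" where
  "recip n p = (\<Sum>i\<le>n. monom (coeff p i) (n - i))"

lemma coeff_recip: "coeff (recip n p) i = (if i \<le> n then coeff p (n - i) else 0)"
proof -
  have "coeff (recip n p) i = (\<Sum>j\<le>n. if j = n - i \<and> i \<le> n then coeff p j else 0)"
    unfolding recip_def coeff_sum coeff_monom by (intro sum.cong) auto
  also have "\<dots> = (if i \<le> n then coeff p (n - i) else 0)"
    by (cases "i \<le> n") auto
  finally show ?thesis .
qed

lemma poly_recip:
  assumes "degree p \<le> n" "x \<noteq> 0"
  shows "poly (recip n p) x = x ^ n * poly p (1 / x)"
proof -
  have "poly p (1 / x) = (\<Sum>i\<le>n. coeff p i * (1 / x) ^ i)"
    unfolding poly_altdef using assms(1)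
    by (intro sum.mono_neutral_left) (auto intro: coeff_eq_0 simp: not_le)
  then show ?thesis
    using assms(2) unfolding recip_def
    by (auto simp: poly_sum poly_monom sum_distrib_left power_diff field_simps intro!: sum.cong)
qed

definition recip_decomposition :: "nat \<Rightarrow> real poly \<Rightarrow> real poly \<Rightarrow> real poly \<Rightarrow> bool" where
  "recip_decomposition n p a b \<longleftrightarrow>
     degree a \<le> n \<and> degree b \<le> n - 1 \<and>
     p = a + [:0, 1:] * b \<and> recip n a = a \<and> recip (n - 1) b = b"

lemma recip_add: "recip n (p + q) = recip n p + recip n q"
  and recip_diff: "recip n (p - q) = recip n p - recip n q"
  by (auto simp: poly_eq_iff coeff_recip)

lemma recip_X_mult:
  assumes "degree q \<le> n - 1" "n \<ge> 1"
  shows "recip n ([:0, 1:] * q) = recip (n - 1) q"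
proof (rule poly_eqI)
  fix i
  have "coeff ([:0, 1:] * q) (n - i) = (if i < n then coeff q (n - 1 - i) else 0)"
    using assms(2) by (cases "n - i") (auto simp: coeff_pCons intro!: arg_cong[where f = "coeff q"])
  then show "coeff (recip n ([:0, 1:] * q)) i = coeff (recip (n - 1) q) i"
    using assms(2) by (auto simp: coeff_recip simp del: mult_pCons_left)
qed

lemma recip_Suc:
  assumes "degree q \<le> n - 1" "n \<ge> 1"
  shows "recip n q = [:0, 1:] * recip (n - 1) q"
proof (rule poly_eqI)
  fix i
  show "coeff (recip n q) i = coeff ([:0, 1:] * recip (n - 1) q) i"
    using assms by (cases i) (auto simp: coeff_recip coeff_eq_0)
qed

lemma recip_recip: "degree p \<le> n \<Longrightarrow> recip n (recip n p) = p"
  by (auto simp: poly_eq_iff coeff_recip coeff_eq_0)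

lemma ex1_recip_decomposition:
  assumes "n \<ge> 1" "degree p \<le> n"
  shows "\<exists>!(a, b). recip_decomposition n p a b"
proof -
  have key: "[:-1, 1:] * b = p - recip n p" if "recip_decomposition n p a b" for a b
  proof -
    have "recip n p = a + b"
      using that recip_X_mult[OF _ assms(1), of b] unfolding recip_decomposition_def
      by (metis recip_add)
    then show ?thesis using that by (simp add: recip_decomposition_def)
  qed
  have "[:-1, 1:] dvd p - recip n p"
    using poly_eq_0_iff_dvd[of "p - recip n p" 1] poly_recip[OF assms(2), of 1] by simp
  then obtain b where b: "p - recip n p = [:-1, 1:] * b" by (auto elim: dvdE)
  have degr: "degree (recip n p) \<le> n"
    by (rule degree_le) (auto simp: coeff_recip)
  have degb: "degree b \<le> n - 1"
  proof (cases "b = 0")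
    case False
    have "degree ([:-1, 1:] * b) = 1 + degree b"
      using False by (subst degree_mult_eq) auto
    moreover have "degree (p - recip n p) \<le> n" using degr assms(2) by (rule degree_diff_le[rotated])
    ultimately show ?thesis using b by simp
  qed simp
  have "recip n ([:0, 1:] * b - b) = - ([:0, 1:] * b - b)"
  proof -
    have "[:0, 1:] * b - b = p - recip n p" using b by simp
    then show ?thesis by (simp add: recip_diff recip_recip[OF assms(2)])
  qed
  then have "recip (n - 1) b - [:0, 1:] * recip (n - 1) b = - ([:0, 1:] * b - b)"
    using recip_Suc[OF degb assms(1)] recip_X_mult[OF degb assms(1)] by (simp add: recip_diff)
  then have "[:-1, 1:] * (recip (n - 1) b) = [:-1, 1:] * b"
    by (simp add: algebra_simps)
  then have rb: "recip (n - 1) b = b" by (metis mult_cancel_left one_neq_zero pCons_eq_0_iff)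
  define a where "a = p - [:0, 1:] * b"
  have a2: "a = recip n p - b"
    using b by (simp add: a_def algebra_simps)
  have "recip n a = recip n p - b"
    unfolding a_def by (simp only: recip_diff recip_X_mult[OF degb assms(1)] rb)
  moreover have "degree a \<le> n"
    unfolding a2 using degb degr by (intro degree_diff_le) auto
  ultimately have ex: "recip_decomposition n p a b"
    using rb degb a2 by (simp add: recip_decomposition_def a_def)
  show ?thesis
  proof (rule ex1I[of _ "(a, b)"])
    show "case (a, b) of (a, b) \<Rightarrow> recip_decomposition n p a b" using ex by simp
  next
    fix ab assume "case ab of (a, b) \<Rightarrow> recip_decomposition n p a b"
    then obtain a' b' where ab: "ab = (a', b')" "recip_decomposition n p a' b'"
      by (cases ab) auto
    have "[:-1, 1:] * b' = [:-1, 1:] * b" using key[OF ab(2)] key[OF ex] by simp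
    then have "b' = b" by (metis mult_cancel_left one_neq_zero pCons_eq_0_iff)
    then show "ab = (a, b)" using ab ex by (simp add: recip_decomposition_def)
  qed
qed

text \<open>All complex zeros are real; in particular the zero polynomial is not real-rooted.\<close>

definition real_rooted :: "real poly \<Rightarrow> bool" where
  "real_rooted p \<longleftrightarrow> (\<forall>z::complex. poly (map_poly complex_of_real p) z = 0 \<longrightarrow> z \<in> \<real>)"

text \<open>Real zeros with multiplicity in decreasing order, indexed from 0.\<close>

definition zeros :: "real poly \<Rightarrow> real list" where
  "zeros p = rev (sorted_list_of_multiset (proots p))"

lemma length_zeros: "real_rooted p \<Longrightarrow> length (zeros p) = degree p"
proof -
  have "real_rooted p \<Longrightarrow> size (proots p) = degree p"
  proof (induction "degree p" arbitrary: p)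
    case 0
    then obtain c where c: "p = [:c:]" by (metis degree_eq_zeroE)
    then show ?case by (cases "c = 0") auto
  next
    case (Suc d)
    have deg: "degree (map_poly complex_of_real p) = Suc d"
      using Suc.hyps(2) by (simp add: degree_map_poly)
    have "\<not> constant (poly (map_poly complex_of_real p))"
      using deg by (simp add: constant_degree)
    then obtain z where z: "poly (map_poly complex_of_real p) z = 0"
      using fundamental_theorem_of_algebra by blast
    then obtain r where r: "z = complex_of_real r"
      using Suc.prems by (auto simp: real_rooted_def elim: Reals_cases)
    have ev: "poly (map_poly complex_of_real q) (complex_of_real x) = complex_of_real (poly q x)"
      for q x by (induction q) (auto simp: map_poly_pCons)
    have "poly p r = 0" using z r ev by simp
    then obtain q where q: "p = [:-r, 1:] * q" by (auto simp: poly_eq_0_iff_dvd elim: dvdE)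
    have "q \<noteq> 0" using q Suc.hyps(2) by auto
    then have dq: "degree q = d"
      using Suc.hyps(2) unfolding q by (subst (asm) degree_mult_eq) auto
    have mq: "map_poly complex_of_real p = [:- of_real r, 1:] * map_poly complex_of_real q"
      unfolding q by (simp add: poly_eq_iff coeff_map_poly coeff_pCons split: nat.splits)
    have "real_rooted q"
      using Suc.prems unfolding real_rooted_def mq by auto
    then have "size (proots q) = d" using Suc.hyps(1) dq by auto
    then show ?case
      using Suc.hyps(2) \<open>q \<noteq> 0\<close> unfolding q by (subst proots_mult) auto
  qed
  then show "real_rooted p \<Longrightarrow> length (zeros p) = degree p"
    by (simp add: zeros_def flip: size_mset)
qed

definition preceq_poly :: "real poly \<Rightarrow> real poly \<Rightarrow> bool" (infix "\<preceq>" 50) where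
  "g \<preceq> f \<longleftrightarrow> real_rooted g \<and> real_rooted f \<and>
     (let r = zeros f; s = zeros g in
       (degree f = degree g + 1 \<and>
          (\<forall>i<degree g. r ! (i + 1) \<le> s ! i \<and> s ! i \<le> r ! i)) \<or>
       (degree f = degree g \<and>
          (\<forall>i<degree f. s ! i \<le> r ! i) \<and> (\<forall>i. i + 1 < degree f \<longrightarrow> r ! (i + 1) \<le> s ! i)))"

definition interlaces :: "real poly \<Rightarrow> real poly \<Rightarrow> bool" (infix "\<lless>" 50) where
  "g \<lless> f \<longleftrightarrow>
     (g \<preceq> f \<and> sgn (lead_coeff g) = sgn (lead_coeff f)) \<or>
     (f \<preceq> g \<and> sgn (lead_coeff g) = - sgn (lead_coeff f)) \<or>
     (g = 0 \<and> real_rooted f) \<or> (f = 0 \<and> real_rooted g)"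

text \<open>
  With \<open>n = degree p\<close>: the chain
  \<open>0 \<le> p\<^sub>0 \<le> p\<^sub>n \<le> p\<^sub>1 \<le> p\<^bsub>n-1\<^esub> \<le> \<dots>\<close>,
  which stops at the index \<open>\<lfloor>(n+1)/2\<rfloor>\<close>, split into its two kinds of links.
\<close>

definition alternatingly_increasing :: "real poly \<Rightarrow> bool" where
  "alternatingly_increasing p \<longleftrightarrow> (let n = degree p in
     0 \<le> coeff p 0 \<and>
     (\<forall>i. 2 * i < n \<longrightarrow> coeff p i \<le> coeff p (n - i)) \<and>
     (\<forall>i. 2 * i + 1 < n \<longrightarrow> coeff p (n - i) \<le> coeff p (i + 1)))"

end

theory Submission
  imports Defs
begin

text \<open>
  Let \<open>A\<^bsub>n,c\<^esub>\<close> count words by ascents with \<open>w\<^sub>0 = c\<close> in place of \<open>w\<^sub>0 = 0\<close>. Splitting off the first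
  letter gives \<open>A\<^bsub>n+1,c\<^esub> = \<Sum>\<^bsub>j\<le>c\<^esub> A\<^bsub>n,j\<^esub> + x \<Sum>\<^bsub>j>c\<^esub> A\<^bsub>n,j\<^esub>\<close>, which is also the recursion for the sections
  of \<open>(1 + t + \<dots> + t\<^bsup>k-1\<^esup>)\<^bsup>n+1\<^esup>\<close> along the residue classes modulo \<open>k\<close>. That power is symmetric
  and unimodal, so \<open>A\<^bsub>n,0\<^esub>\<close> is alternatingly increasing and its reversal is \<open>A\<^bsub>n,k-n-1\<^esub>\<close>.

  For a skew form \<open>B\<close> such as the Wronskian at a real point, or \<open>Im (P Q\<^sup>*)\<close> at a point of the upper
  half plane, the recursion preserves the system \<open>B(A\<^sub>i, A\<^sub>j) \<ge> 0\<close>, \<open>B(x A\<^sub>j, A\<^sub>i) > 0\<close> for \<open>i < j\<close>.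
  In the half plane this yields real-rootedness, on the real line strict interlacing.
\<close>

section \<open>Ascents of words and powers of geometric sums\<close>

lemma pCons_0_add: "pCons 0 (P + Q) = pCons 0 P + pCons (0::'a::comm_monoid_add) Q"
  by simp

lemma pCons_0_sum: "pCons 0 (\<Sum>i\<in>S. f i) = (\<Sum>i\<in>S. pCons (0::'a::comm_monoid_add) (f i))"
  by (induction S rule: infinite_finite_induct) (simp_all add: pCons_0_add del: add_pCons)

fun asc_from :: "nat \<Rightarrow> nat list \<Rightarrow> nat" where
  "asc_from c [] = 0"
| "asc_from c (x # w) = (if c < x then 1 else 0) + asc_from x w"

lemma card_ascents_eq_asc_from:
  "card {i \<in> {0..<length w}. (c # w) ! i < (c # w) ! (i + 1)} = asc_from c w"
proof (induction w arbitrary: c)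
  case (Cons x w)
  let ?S = "{i \<in> {0..<length w}. (x # w) ! i < (x # w) ! (i + 1)}"
  have "{i \<in> {0..<length (x # w)}. (c # x # w) ! i < (c # x # w) ! (i + 1)}
      = (if c < x then {0} else {}) \<union> Suc ` ?S"
    by (auto simp: image_iff less_Suc_eq_0_disj)
  also have "card \<dots> = (if c < x then 1 else 0) + card (Suc ` ?S)"
    by (subst card_Un_disjoint) auto
  also have "card (Suc ` ?S) = card ?S"
    by (intro card_image) auto
  finally show ?case using Cons.IH[of x] by simp
qed simp

definition ascent_poly_from :: "nat \<Rightarrow> nat \<Rightarrow> nat \<Rightarrow> real poly" where
  "ascent_poly_from k n c = (\<Sum>w\<in>kwords n k. monom 1 (asc_from c w))"

lemma ascent_poly_eq_from: "ascent_poly n k = ascent_poly_from k n 0"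
  unfolding ascent_poly_def ascent_poly_from_def asc_def card_ascents_eq_asc_from ..

lemma kwords_0: "kwords 0 k = {[]}"
  by (auto simp: kwords_def)

lemma kwords_Suc: "kwords (Suc n) k = (\<lambda>(x, w). x # w) ` ({..<k} \<times> kwords n k)"
  by (auto simp: kwords_def image_iff length_Suc_conv)

lemma ascent_poly_from_0: "ascent_poly_from k 0 c = 1"
  by (simp add: ascent_poly_from_def kwords_0)

lemma ascent_poly_from_Suc_if:
  "ascent_poly_from k (Suc n) c =
     (\<Sum>j<k. if c < j then pCons 0 (ascent_poly_from k n j) else ascent_poly_from k n j)"
proof -
  have "ascent_poly_from k (Suc n) c =
      (\<Sum>(x, w)\<in>{..<k} \<times> kwords n k. monom 1 (asc_from c (x # w)))"
    unfolding ascent_poly_from_def kwords_Suc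
    by (subst sum.reindex) (auto simp: inj_on_def case_prod_unfold)
  also have "\<dots> = (\<Sum>x<k. \<Sum>w\<in>kwords n k. monom 1 (asc_from c (x # w)))"
    by (simp add: sum.cartesian_product)
  also have "\<dots> = (\<Sum>j<k. if c < j then pCons 0 (ascent_poly_from k n j) else ascent_poly_from k n j)"
    by (intro sum.cong)
       (auto simp: ascent_poly_from_def monom_Suc pCons_0_sum)
  finally show ?thesis .
qed

lemma ascent_poly_from_Suc:
  assumes "c < k"
  shows "ascent_poly_from k (Suc n) c =
    (\<Sum>j\<le>c. ascent_poly_from k n j) + pCons 0 (\<Sum>j\<in>{c<..<k}. ascent_poly_from k n j)"
proof -
  have *: "{..<k} = {..c} \<union> {c<..<k}" using assms by auto
  show ?thesis
    unfolding ascent_poly_from_Suc_if *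
    by (subst sum.union_disjoint) (auto simp: pCons_0_sum intro!: arg_cong2[where f = "(+)"] sum.cong)
qed

section \<open>Powers of the geometric sum and their sections modulo \<open>k\<close>\<close>

definition geom_poly :: "nat \<Rightarrow> real poly" where
  "geom_poly k = (\<Sum>j<k. monom 1 j)"

lemma coeff_geom_poly: "coeff (geom_poly k) i = (if i < k then 1 else 0)"
  by (simp add: geom_poly_def coeff_sum)

lemma coeff_geom_poly_mult:
  "coeff (geom_poly k * q) N = (\<Sum>j<k. if j \<le> N then coeff q (N - j) else 0)"
  by (auto simp: geom_poly_def sum_distrib_right coeff_sum coeff_monom_mult intro!: sum.cong)

text \<open>Both sides obey the same recursion in \<open>n\<close>. Multiplying by
  \<open>geom_poly k\<close> adds up the coefficients at \<open>k * m + c - j\<close> for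
  \<open>j < k\<close>: those with \<open>j \<le> c\<close> stay in block \<open>m\<close>, those
  with \<open>j > c\<close> fall into block \<open>m - 1\<close>, which accounts for the factor
  \<open>x\<close>.\<close>

lemma coeff_ascent_poly_from:
  assumes "c < k"
  shows "coeff (ascent_poly_from k n c) m = coeff (geom_poly k ^ Suc n) (k * m + c)"
  using assms
proof (induction n arbitrary: c m)
  case 0
  then show ?case by (cases m) (auto simp: ascent_poly_from_0 coeff_geom_poly)
next
  case (Suc n)
  let ?A = "ascent_poly_from k n" and ?C = "coeff (geom_poly k ^ Suc n)"
  have "{..<k} = {..c} \<union> {c<..<k}" using Suc.prems by auto
  then have split: "sum h {..<k} = sum h {..c} + sum h {c<..<k}" for h :: "nat \<Rightarrow> real"
    by (simp add: sum.union_disjoint disjoint_iff)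
  have 1: "(\<Sum>j\<le>c. coeff (?A j) m) = (\<Sum>j\<le>c. if j \<le> k * m + c then ?C (k * m + c - j) else 0)"
    by (rule sum.reindex_bij_witness[where i = "\<lambda>j. c - j" and j = "\<lambda>j. c - j"])
       (use Suc in auto)
  have 2: "coeff (pCons 0 (\<Sum>j\<in>{c<..<k}. ?A j)) m
      = (\<Sum>j\<in>{c<..<k}. if j \<le> k * m + c then ?C (k * m + c - j) else 0)"
  proof (cases m)
    case 0
    then show ?thesis by auto
  next
    case (Suc m')
    \<comment> \<open>In block \<open>m'\<close> the residue is \<open>k + c - j\<close>, and this
      substitution maps \<open>{c<..<k}\<close> onto itself.\<close>
    show ?thesis unfolding Suc coeff_pCons_Suc coeff_sum
      by (rule sum.reindex_bij_witness[where i = "\<lambda>j. k + c - j" and j = "\<lambda>j. k + c - j"])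
         (use Suc.IH in \<open>auto simp: algebra_simps\<close>)
  qed
  have "coeff (ascent_poly_from k (Suc n) c) m =
      (\<Sum>j<k. if j \<le> k * m + c then ?C (k * m + c - j) else 0)"
    unfolding ascent_poly_from_Suc[OF Suc.prems] coeff_add 2 split by (simp only: 1 coeff_sum)
  also have "\<dots> = coeff (geom_poly k ^ Suc (Suc n)) (k * m + c)"
    by (simp only: power_Suc[of _ "Suc n"] coeff_geom_poly_mult)
  finally show ?case .
qed

lemma coeff_geom_poly_power_nonneg: "coeff (geom_poly k ^ n) i \<ge> 0"
  by (induction n arbitrary: i)
     (auto simp: coeff_1 coeff_geom_poly_mult intro!: sum_nonneg)

text \<open>A window of length \<open>k\<close> slides by one place: one coefficient of
  \<open>q\<close> enters and one leaves.\<close>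

lemma coeff_geom_poly_mult_Suc:
  "coeff (geom_poly k * q) (Suc N) =
     coeff (geom_poly k * q) N + coeff q (Suc N) - (if k \<le> Suc N then coeff q (Suc N - k) else 0)"
proof -
  let ?f = "\<lambda>j. if j \<le> Suc N then coeff q (Suc N - j) else 0"
  have "coeff (geom_poly k * q) N = (\<Sum>j<k. ?f (Suc j))"
    unfolding coeff_geom_poly_mult by (intro sum.cong) auto
  moreover have "(\<Sum>j<k. ?f (Suc j)) + ?f 0 = (\<Sum>j<k. ?f j) + ?f k"
    using sum.lessThan_Suc_shift[of ?f k] sum.lessThan_Suc[of ?f k] by (simp only: add.commute)
  ultimately show ?thesis
    by (simp add: coeff_geom_poly_mult)
qed

context
  fixes k :: nat
  assumes k: "k \<ge> 1"
begin

lemma degree_geom_poly: "degree (geom_poly k) = k - 1"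
  using k by (intro antisym degree_le le_degree) (auto simp: coeff_geom_poly)

lemma reflect_geom_poly: "reflect_poly (geom_poly k) = geom_poly k"
  using k by (auto simp: poly_eq_iff coeff_reflect_poly degree_geom_poly coeff_geom_poly)

lemma degree_geom_poly_power: "degree (geom_poly k ^ n) = (k - 1) * n"
proof -
  have "geom_poly k \<noteq> 0" using k by (auto simp: poly_eq_iff coeff_geom_poly intro!: exI[of _ 0])
  then show ?thesis by (simp add: degree_power_eq degree_geom_poly)
qed

lemma coeff_geom_poly_power_reflect:
  assumes "i + j = (k - 1) * n"
  shows "coeff (geom_poly k ^ n) i = coeff (geom_poly k ^ n) j"
proof -
  have "geom_poly k ^ n = reflect_poly (geom_poly k ^ n)"
    by (simp add: reflect_poly_power reflect_geom_poly)
  then have "coeff (geom_poly k ^ n) i = coeff (reflect_poly (geom_poly k ^ n)) i" by simp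
  also have "\<dots> = coeff (geom_poly k ^ n) j"
    unfolding coeff_reflect_poly degree_geom_poly_power assms[symmetric] by simp
  finally show ?thesis .
qed

text \<open>Symmetry and unimodality around \<open>(k - 1) n / 2\<close> in a single inequality.\<close>

lemma coeff_geom_poly_power_mono:
  assumes "i \<le> j" "i + j \<le> (k - 1) * n"
  shows "coeff (geom_poly k ^ n) i \<le> coeff (geom_poly k ^ n) j"
  using assms
proof (induction n arbitrary: i j)
  case 0
  then show ?case by simp
next
  case (Suc n)
  let ?c = "coeff (geom_poly k ^ n)" and ?d = "coeff (geom_poly k ^ Suc n)"
  \<comment> \<open>The increment is \<open>?c (Suc i) - ?c (Suc i - k)\<close>. These two indices
    add up to \<open>2 * i + 2 - k \<le> (k - 1) * n\<close>, exactly the range of the induction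
    hypothesis.\<close>
  have step_up: "?d i \<le> ?d (Suc i)" if "2 * i + 1 \<le> (k - 1) * Suc n" for i
  proof (cases "k \<le> Suc i")
    case True
    then have "?c (Suc i - k) \<le> ?c (Suc i)"
      using that by (intro Suc.IH) (auto simp: algebra_simps)
    then show ?thesis
      using True coeff_geom_poly_mult_Suc[of k "geom_poly k ^ n" i] by simp
  next
    case False
    then show ?thesis
      using coeff_geom_poly_mult_Suc[of k "geom_poly k ^ n" i]
        coeff_geom_poly_power_nonneg[of k n "Suc i"] by simp
  qed
  have chain: "?d i \<le> ?d j" if "i \<le> j" "2 * j \<le> (k - 1) * Suc n + 1" for i j
    using that
  proof (induction j rule: dec_induct)
    case (step j)
    then have "?d i \<le> ?d j" by simp
    also have "\<dots> \<le> ?d (Suc j)" using step.prems by (intro step_up) simp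
    finally show ?case .
  qed simp
  show ?case
  proof (cases "2 * j \<le> (k - 1) * Suc n")
    case True
    then show ?thesis using Suc.prems chain by simp
  next
    case False
    \<comment> \<open>Beyond the centre \<open>j\<close> is replaced by its mirror image, which lies
      in the increasing half and is still at least \<open>i\<close>.\<close>
    have "?d i \<le> ?d ((k - 1) * Suc n - j)"
      using Suc.prems False by (intro chain) linarith+
    also have "\<dots> = ?d j"
      using Suc.prems by (intro coeff_geom_poly_power_reflect) linarith
    finally show ?thesis .
  qed
qed

lemma coeff_geom_poly_power_ge_1:
  assumes "j \<le> (k - 1) * n"
  shows "coeff (geom_poly k ^ n) j \<ge> 1"
proof -
  have "coeff (geom_poly k ^ n) 0 = 1"
    using k by (simp add: coeff_0_power coeff_geom_poly)
  then show ?thesis using coeff_geom_poly_power_mono[of 0 j n] assms by simp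
qed

end

section \<open>Coefficients of the ascent polynomial for \<open>k > n\<close>\<close>

context
  fixes k n :: nat
  assumes kn: "k > n"
begin

text \<open>The degree of the power lies in block \<open>n\<close> at residue
  \<open>k - n - 1\<close>. This yields the degree of the ascent polynomial and the residue that the
  symmetry pairs with 0.\<close>

lemma pred_mult_Suc_eq: "(k - 1) * Suc n = k * n + (k - n - 1)"
proof -
  obtain d where "k = n + 1 + d" using kn by (metis Suc_eq_plus1 Suc_leI le_iff_add)
  then show ?thesis by simp
qed

lemma coeff_ascent_poly: "coeff (ascent_poly n k) m = coeff (geom_poly k ^ Suc n) (k * m)"
  using kn coeff_ascent_poly_from[of 0 k n m] by (simp add: ascent_poly_eq_from)

lemma degree_ascent_poly: "degree (ascent_poly n k) = n"
proof (rule antisym)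
  have "coeff (ascent_poly n k) i = 0" if "n < i" for i
  proof -
    have "k * i \<ge> k * Suc n" using that by (intro mult_left_mono) auto
    then have "k * i > (k - 1) * Suc n" using kn pred_mult_Suc_eq by simp
    then show ?thesis
      unfolding coeff_ascent_poly using kn
      by (intro coeff_eq_0) (simp only: degree_geom_poly_power[of k])
  qed
  then show "degree (ascent_poly n k) \<le> n" by (intro degree_le) blast
  have "coeff (ascent_poly n k) n \<ge> 1"
    unfolding coeff_ascent_poly
    using coeff_geom_poly_power_ge_1[of k "k * n" "Suc n"] kn pred_mult_Suc_eq by simp
  then show "n \<le> degree (ascent_poly n k)" by (intro le_degree) simp
qed

lemma coeff_ascent_poly_0: "coeff (ascent_poly n k) 0 = 1"
  unfolding coeff_ascent_poly using kn by (simp add: coeff_0_power coeff_geom_poly coeff_mult_0)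

lemma coeff_ascent_poly_nonneg: "coeff (ascent_poly n k) i \<ge> 0"
  unfolding coeff_ascent_poly by (rule coeff_geom_poly_power_nonneg)

text \<open>The symmetry of the power exchanges the indices \<open>k * (n - i)\<close> and
  \<open>k * i + (k - n - 1)\<close>.\<close>

lemma recip_ascent_poly: "recip n (ascent_poly n k) = ascent_poly_from k n (k - n - 1)"
proof (rule poly_eqI)
  fix i
  have less: "k - n - 1 < k" using kn by simp
  show "coeff (recip n (ascent_poly n k)) i = coeff (ascent_poly_from k n (k - n - 1)) i"
  proof (cases "i \<le> n")
    case True
    have "k * (n - i) + k * i = k * n"
      using True by (simp flip: distrib_left)
    then have "coeff (geom_poly k ^ Suc n) (k * (n - i)) = coeff (geom_poly k ^ Suc n) (k * i + (k - n - 1))"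
      using kn pred_mult_Suc_eq by (intro coeff_geom_poly_power_reflect) linarith+
    then show ?thesis
      using True by (simp only: coeff_recip coeff_ascent_poly coeff_ascent_poly_from[OF less] if_True)
  next
    case False
    then have "k * i \<ge> k * Suc n" by (intro mult_left_mono) auto
    then have "k * i + (k - n - 1) > (k - 1) * Suc n" using kn pred_mult_Suc_eq by simp
    then have "coeff (geom_poly k ^ Suc n) (k * i + (k - n - 1)) = 0"
      using kn by (intro coeff_eq_0) (simp only: degree_geom_poly_power[of k])
    then show ?thesis
      using False by (simp only: coeff_recip coeff_ascent_poly_from[OF less] if_False)
  qed
qed

text \<open>Both kinds of links reduce to \<open>coeff_geom_poly_power_mono\<close>. In the second
  kind \<open>k * (n - i)\<close> is the larger index, so it is first reflected to
  \<open>k * i + (k - n - 1)\<close>.\<close>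

lemma alternatingly_increasing_ascent_poly: "alternatingly_increasing (ascent_poly n k)"
  unfolding alternatingly_increasing_def Let_def degree_ascent_poly
proof (intro conjI allI impI)
  show "0 \<le> coeff (ascent_poly n k) 0" by (rule coeff_ascent_poly_nonneg)
next
  fix i assume i: "2 * i < n"
  have "k * i \<le> k * (n - i)" using i by (intro mult_left_mono) auto
  moreover have "k * (n - i) + k * i = k * n"
    using i by (simp flip: distrib_left)
  ultimately show "coeff (ascent_poly n k) i \<le> coeff (ascent_poly n k) (n - i)"
    unfolding coeff_ascent_poly using kn pred_mult_Suc_eq
    by (intro coeff_geom_poly_power_mono) linarith+
next
  fix i assume i: "2 * i + 1 < n"
  have sum: "k * (n - i) + k * i = k * n"
    using i by (simp flip: distrib_left)
  have le: "k * (i + 1) \<le> k * (n - i)" using i by (intro mult_left_mono) auto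
  have "coeff (ascent_poly n k) (n - i) = coeff (geom_poly k ^ Suc n) (k * i + (k - n - 1))"
    unfolding coeff_ascent_poly using kn pred_mult_Suc_eq sum
    by (intro coeff_geom_poly_power_reflect) linarith+
  also have "\<dots> \<le> coeff (geom_poly k ^ Suc n) (k * (i + 1))"
    using kn pred_mult_Suc_eq sum le
    by (intro coeff_geom_poly_power_mono) (simp_all add: distrib_left)
  finally show "coeff (ascent_poly n k) (n - i) \<le> coeff (ascent_poly n k) (i + 1)"
    unfolding coeff_ascent_poly .
qed

end

section \<open>Skew forms preserved by the word recursion\<close>

text \<open>
  The two instances below are the Wronskian \<open>P' Q - P Q'\<close> at a real point and
  \<open>Im (P Q\<^sup>*)\<close> at a point of the upper half plane, \<open>Q\<^sup>*\<close> denoting the conjugate.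
  Multiplication by the variable is written \<open>pCons 0\<close>.
\<close>

locale interlacing_form =
  fixes B :: "real poly \<Rightarrow> real poly \<Rightarrow> real" and c :: real
  assumes add_left: "B (P + P') Q = B P Q + B P' Q"
    and skew: "B Q P = - B P Q"
    and X_X: "B (pCons 0 P) (pCons 0 Q) = c * B P Q"
    and scale_nonneg: "c \<ge> 0"
    and X_self_nonneg: "B (pCons 0 P) P \<ge> 0"
    and X_1_pos: "B (pCons 0 1) 1 > 0"
begin

lemma add_right: "B P (Q + Q') = B P Q + B P Q'"
  using add_left[of Q Q' P] skew by (metis minus_add_distrib)

lemma zero_left: "B 0 Q = 0"
  using add_left[of 0 0 Q] by simp

lemma zero_right: "B P 0 = 0"
  using add_right[of P 0 0] by simp

lemma self: "B P P = 0"
  using skew[of P P] by simp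

lemma sum_left: "B (\<Sum>i\<in>S. f i) Q = (\<Sum>i\<in>S. B (f i) Q)"
  by (induction S rule: infinite_finite_induct) (auto simp: zero_left add_left)

lemma sum_right: "B P (\<Sum>i\<in>S. f i) = (\<Sum>i\<in>S. B P (f i))"
  by (induction S rule: infinite_finite_induct) (auto simp: zero_right add_right)

lemmas expand = pCons_0_add add_left add_right X_X self

text \<open>The terms \<open>B U (pCons 0 T)\<close> and \<open>B (pCons 0 T) U\<close> cancel by
  skewness; all others have a known sign.\<close>

lemma block_less:
  "B (U + pCons 0 (V + T)) (U + V + pCons 0 T) =
     B U V + B (pCons 0 V) U + B (pCons 0 V) V + c * B V T + B (pCons 0 T) V"
  using skew[of U "pCons 0 T"] by (simp add: expand del: add_pCons)

text \<open>With \<open>W = U + x T\<close> the arguments are \<open>x (W + V)\<close> and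
  \<open>W + x V\<close>. The term \<open>B (x W) W\<close> stays whole, since
  \<open>X_self_nonneg\<close> gives its sign only in this form.\<close>

lemma block_X:
  "B (pCons 0 (U + V + pCons 0 T)) (U + pCons 0 (V + T)) =
     B (pCons 0 (U + pCons 0 T)) (U + pCons 0 T) + c * B U V + B (pCons 0 V) U
       + c * B V T + c * B (pCons 0 T) V"
  using skew[of V U] by (simp add: expand algebra_simps del: add_pCons)

text \<open>All terms of the two block expansions are nonnegative, and
  \<open>B (pCons 0 V) U\<close> is positive: \<open>U\<close> and \<open>V\<close> are nonempty
  sums, and each index in \<open>V\<close> exceeds each index in \<open>U\<close>. So even the weak
  inequality becomes strict.\<close>

lemma word_recursion_step:
  fixes f g :: "nat \<Rightarrow> real poly"
  assumes nonneg: "\<And>i j. i < j \<Longrightarrow> j < k \<Longrightarrow> B (f i) (f j) \<ge> 0"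
    and X_pos: "\<And>i j. i < j \<Longrightarrow> j < k \<Longrightarrow> B (pCons 0 (f j)) (f i) > 0"
    and g: "\<And>i. i < k \<Longrightarrow> g i = (\<Sum>j\<le>i. f j) + pCons 0 (\<Sum>j\<in>{i<..<k}. f j)"
    and ij: "i < j" "j < k"
  shows "B (g i) (g j) > 0" "B (pCons 0 (g j)) (g i) > 0"
proof -
  define U V T where "U = (\<Sum>l\<le>i. f l)" "V = (\<Sum>l\<in>{i<..j}. f l)" "T = (\<Sum>l\<in>{j<..<k}. f l)"
  have "{..j} = {..i} \<union> {i<..j}" "{i<..<k} = {i<..j} \<union> {j<..<k}" using ij by auto
  then have "(\<Sum>l\<le>j. f l) = U + V" "(\<Sum>l\<in>{i<..<k}. f l) = V + T"
    unfolding U_V_T_def by (simp_all add: sum.union_disjoint disjoint_iff)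
  then have gi: "g i = U + pCons 0 (V + T)" and gj: "g j = U + V + pCons 0 T"
    using g[of i] g[of j] ij by (auto simp: U_V_T_def)
  have UV: "B U V \<ge> 0" and VT: "B V T \<ge> 0"
    using ij by (auto simp: U_V_T_def sum_left sum_right intro!: sum_nonneg nonneg)
  have TV: "B (pCons 0 T) V \<ge> 0"
    using ij by (auto simp: U_V_T_def pCons_0_sum sum_left sum_right intro!: sum_nonneg less_imp_le[OF X_pos])
  have VU: "B (pCons 0 V) U > 0"
    unfolding U_V_T_def pCons_0_sum sum_left sum_right using ij
    by (intro sum_pos X_pos) auto
  have V2: "B (pCons 0 V) V \<ge> 0" and UT: "B (pCons 0 (U + pCons 0 T)) (U + pCons 0 T) \<ge> 0"
    by (rule X_self_nonneg)+
  show "B (g i) (g j) > 0"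
    unfolding gi gj block_less using UV VT TV VU V2 scale_nonneg
    by (simp add: add_nonneg_pos add_pos_nonneg)
  show "B (pCons 0 (g j)) (g i) > 0"
    unfolding gi gj block_X using UV VT TV VU UT scale_nonneg
    by (simp add: add_nonneg_pos add_pos_nonneg del: add_pCons)
qed

end

text \<open>Here \<open>B (x P) P\<close> is the square of \<open>P\<close> at the point, and
  \<open>B x 1 = 1\<close>.\<close>

lemma interlacing_form_Wronskian:
  "interlacing_form
     (\<lambda>P Q. poly (pderiv P) x * poly Q x - poly P x * poly (pderiv Q) x) (x\<^sup>2)"
  by unfold_locales
     (auto simp: pderiv_pCons pderiv_add algebra_simps power2_eq_square)

lemma poly_of_real_add:
  "poly (map_poly complex_of_real (P + Q)) z
     = poly (map_poly complex_of_real P) z + poly (map_poly complex_of_real Q) z"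
proof -
  have "map_poly complex_of_real (P + Q) = map_poly of_real P + map_poly of_real Q"
    by (simp add: poly_eq_iff coeff_map_poly)
  then show ?thesis by simp
qed

text \<open>Here \<open>B (x P) P\<close> is \<open>Im z\<close> times the squared modulus of
  \<open>P\<close> at \<open>z\<close>, so the upper half plane supplies the positivity.\<close>

lemma interlacing_form_Im:
  assumes "Im z > 0"
  shows "interlacing_form
     (\<lambda>P Q. Im (poly (map_poly complex_of_real P) z * cnj (poly (map_poly complex_of_real Q) z)))
     ((cmod z)\<^sup>2)"
proof unfold_locales
  fix P Q :: "real poly"
  let ?P = "poly (map_poly complex_of_real P) z" and ?Q = "poly (map_poly complex_of_real Q) z"
  have X: "poly (map_poly complex_of_real (pCons 0 R)) z = z * poly (map_poly complex_of_real R) z" for R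
    by (simp add: map_poly_pCons)
  show "Im (poly (map_poly complex_of_real (pCons 0 P)) z * cnj (poly (map_poly complex_of_real (pCons 0 Q)) z)) =
        (cmod z)\<^sup>2 * Im (?P * cnj ?Q)"
    unfolding X cmod_power2 by (simp add: algebra_simps power2_eq_square)
  have "Im (z * ?P * cnj ?P) = Im z * (cmod ?P)\<^sup>2"
    unfolding cmod_power2 by (simp add: algebra_simps power2_eq_square)
  then show "Im (poly (map_poly complex_of_real (pCons 0 P)) z * cnj ?P) \<ge> 0"
    unfolding X using assms by simp
qed (use assms in \<open>auto simp: poly_of_real_add algebra_simps map_poly_pCons\<close>)

text \<open>The induction starts with all polynomials equal to 1, where the first form vanishes;
  hence the weak inequality.\<close>

lemma (in interlacing_form) ascent_poly_from_weak:
  assumes "i < j" "j < k"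
  shows "B (ascent_poly_from k n i) (ascent_poly_from k n j) \<ge> 0"
    and "B (pCons 0 (ascent_poly_from k n j)) (ascent_poly_from k n i) > 0"
  using assms
proof (induction n arbitrary: i j)
  case 0
  {
    case 1
    then show ?case by (simp add: ascent_poly_from_0 self)
  next
    case 2
    then show ?case by (simp add: ascent_poly_from_0 X_1_pos)
  }
next
  case (Suc n)
  note * = word_recursion_step[where f = "ascent_poly_from k n" and g = "ascent_poly_from k (Suc n)",
      OF Suc.IH ascent_poly_from_Suc]
  {
    case 1
    then show ?case using *(1) by (simp add: less_imp_le)
  next
    case 2
    then show ?case using *(2) by simp
  }
qed

lemma (in interlacing_form) ascent_poly_from_pos:
  assumes "n \<ge> 1" "i < j" "j < k"
  shows "B (ascent_poly_from k n i) (ascent_poly_from k n j) > 0"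
proof -
  obtain m where m: "n = Suc m" using assms(1) by (cases n) auto
  show ?thesis
    unfolding m
    by (rule word_recursion_step(1)[where f = "ascent_poly_from k m" and k = k, OF ascent_poly_from_weak ascent_poly_from_Suc])
       (use assms in auto)
qed

text \<open>At a zero of \<open>ascent_poly_from k n 0\<close> in the upper half plane the form
  \<open>B (x A_1) A_0\<close> would vanish, although it is positive. Conjugation covers the lower
  half plane, and \<open>k \<ge> 2\<close> makes the letter 1 available.\<close>

lemma real_rooted_ascent_poly:
  assumes "k \<ge> 2"
  shows "real_rooted (ascent_poly n k)"
  unfolding real_rooted_def
proof (intro allI impI, rule ccontr)
  fix z
  let ?ev = "\<lambda>P. poly (map_poly complex_of_real P)"
  assume root: "?ev (ascent_poly n k) z = 0" and "z \<notin> \<real>"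
  then have "Im z \<noteq> 0" by (simp add: complex_is_Real_iff)
  define w where "w = (if Im z > 0 then z else cnj z)"
  have w: "Im w > 0" using \<open>Im z \<noteq> 0\<close> by (auto simp: w_def)
  have "?ev (ascent_poly_from k n 0) w = 0"
    using root poly_cnj_real[of "map_poly complex_of_real (ascent_poly n k)" z]
    by (auto simp: w_def ascent_poly_eq_from coeff_map_poly)
  then show False
    using interlacing_form.ascent_poly_from_weak(2)[OF interlacing_form_Im[OF w], of 0 1 k n] assms
    by simp
qed

section \<open>Simple real zeros and sign changes\<close>

lemma sgn_prod_diff:
  fixes c :: "'a \<Rightarrow> real"
  assumes "finite J" "\<And>j. j \<in> J \<Longrightarrow> c j \<noteq> x"
  shows "sgn (\<Prod>j\<in>J. x - c j) = (-1) ^ card {j\<in>J. x < c j}"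
  using assms
proof (induction J rule: finite_induct)
  case (insert a J)
  have "{j \<in> insert a J. x < c j} = (if x < c a then {a} else {}) \<union> {j\<in>J. x < c j}" by auto
  then have "card {j \<in> insert a J. x < c j} = (if x < c a then 1 else 0) + card {j\<in>J. x < c j}"
    using insert by (auto simp: card_insert_if)
  moreover have "sgn (x - c a) = (-1) ^ (if x < c a then 1 else 0)"
    using insert.prems[of a] by (auto simp: sgn_if)
  ultimately show ?case using insert by (simp add: sgn_mult power_add)
qed simp

lemma product_of_roots:
  fixes r :: "nat \<Rightarrow> real"
  assumes "degree f \<le> d" "f \<noteq> 0"
    and root: "\<And>i. i < d \<Longrightarrow> poly f (r i) = 0"
    and strict: "\<And>i j. i < j \<Longrightarrow> j < d \<Longrightarrow> r j < r i"
  shows "f = smult (lead_coeff f) (\<Prod>i<d. [:- r i, 1:])"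
    and "degree f = d" "real_rooted f" "zeros f = map r [0..<d]"
proof -
  \<comment> \<open>Only \<open>degree f \<le> d\<close> is known here, so \<open>a\<close> is the
    coefficient at \<open>d\<close>. The difference from \<open>smult a ?P\<close> has degree below
    \<open>d\<close> but \<open>d\<close> zeros.\<close>
  define a where "a = coeff f d"
  let ?P = "\<Prod>i<d. [:- r i, 1:]"
  have inj: "inj_on r {..<d}"
    by (intro linorder_inj_onI) (use strict in force)+
  have degP: "degree ?P = d" by (simp add: degree_prod_eq_sum_degree)
  have lcP: "lead_coeff ?P = 1" by (simp add: lead_coeff_prod)
  have f: "f = smult a ?P"
  proof (rule ccontr)
    let ?D = "f - smult a ?P"
    assume "f \<noteq> smult a ?P"
    then have D: "?D \<noteq> 0" by simp
    have "degree ?D \<le> d"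
      using assms(1) degP by (intro degree_diff_le) (auto intro: order_trans[OF degree_smult_le])
    moreover have "coeff ?D d = 0" using lcP degP by (simp add: a_def)
    then have "degree ?D \<noteq> d" using D by (metis leading_coeff_0_iff)
    ultimately have "degree ?D < d" by simp
    moreover have "r ` {..<d} \<subseteq> {x. poly ?D x = 0}"
      using root by (auto simp: poly_prod)
    then have "card (r ` {..<d}) \<le> card {x. poly ?D x = 0}"
      using D by (intro card_mono poly_roots_finite)
    then have "d \<le> degree ?D"
      using card_poly_roots_bound[OF D] card_image[OF inj] by simp
    ultimately show False by simp
  qed
  have "a \<noteq> 0" using f assms(2) by auto
  show deg: "degree f = d"
    using \<open>a \<noteq> 0\<close> degP unfolding f by simp
  show "f = smult (lead_coeff f) ?P" using f deg a_def by simp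
  have "map_poly complex_of_real f = smult (of_real a) (\<Prod>i<d. [:- of_real (r i), 1:])"
  proof -
    have *: "map_poly complex_of_real (p * q) = map_poly of_real p * map_poly of_real q" for p q
      by (simp add: poly_eq_iff coeff_map_poly coeff_mult)
    have "map_poly complex_of_real (\<Prod>i\<in>S. [:- r i, 1:]) = (\<Prod>i\<in>S. [:- of_real (r i), 1:])"
      if "finite S" for S
      using that by (induction S rule: finite_induct) (simp_all add: * map_poly_pCons del: mult_pCons_left)
    then show ?thesis unfolding f by (simp add: map_poly_smult)
  qed
  then show "real_rooted f" using \<open>a \<noteq> 0\<close>
    by (auto simp: real_rooted_def poly_prod)
  have "proots (\<Prod>i\<in>S. [:- r i, 1:]) = image_mset r (mset_set S)" if "finite S" for S
    using that
  proof (induction S rule: finite_induct)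
    case (insert x S)
    have "(\<Prod>i\<in>S. [:- r i, 1:]) \<noteq> 0" using insert by simp
    then show ?case using insert by (simp add: proots_mult del: mult_pCons_left)
  qed simp
  then have "proots f = mset (map r [0..<d])"
    using \<open>a \<noteq> 0\<close> unfolding f by (simp add: atLeast0LessThan)
  moreover have "sorted (rev (map r [0..<d]))"
    using strict by (auto simp: sorted_rev_iff_nth_mono nat_less_le[symmetric] le_less)
  ultimately have "sorted_list_of_multiset (proots f) = rev (map r [0..<d])"
    by (metis mset_rev sorted_list_of_multiset_mset sorted_sort_id)
  then show "zeros f = map r [0..<d]" by (simp add: zeros_def)
qed

text \<open>A degree bound suffices, because \<open>d\<close> distinct zeros of a nonzero polynomial
  force equality.\<close>

definition simple_zeros :: "real poly \<Rightarrow> nat \<Rightarrow> (nat \<Rightarrow> real) \<Rightarrow> bool" where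
  "simple_zeros f d r \<longleftrightarrow> f \<noteq> 0 \<and> degree f \<le> d \<and>
     (\<forall>i<d. poly f (r i) = 0) \<and> (\<forall>i j. i < j \<longrightarrow> j < d \<longrightarrow> r j < r i)"

lemma
  assumes "simple_zeros f d r"
  shows simple_zeros_product: "f = smult (lead_coeff f) (\<Prod>i<d. [:- r i, 1:])"
    and simple_zeros_degree: "degree f = d"
    and simple_zeros_real_rooted: "real_rooted f"
    and simple_zeros_zeros: "zeros f = map r [0..<d]"
  using product_of_roots[of f d r] assms by (auto simp: simple_zeros_def)

lemma sgn_poly_simple_zeros:
  assumes "simple_zeros f d r" "m \<le> d"
    and less: "\<And>i. i < m \<Longrightarrow> x < r i" and greater: "\<And>i. m \<le> i \<Longrightarrow> i < d \<Longrightarrow> r i < x"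
  shows "sgn (poly f x) = sgn (lead_coeff f) * (-1) ^ m"
proof -
  have "{i \<in> {..<d}. x < r i} = {..<m}"
    using assms(2) less greater by (force simp: not_le)
  moreover have "sgn (\<Prod>i\<in>{..<d}. x - r i) = (-1) ^ card {i \<in> {..<d}. x < r i}"
    by (intro sgn_prod_diff) (auto, metis less greater less_irrefl not_le)
  ultimately have "sgn (\<Prod>i<d. x - r i) = (-1) ^ m" by simp
  moreover have "poly f x = lead_coeff f * (\<Prod>i<d. x - r i)"
    by (subst simple_zeros_product[OF assms(1)]) (simp add: poly_prod)
  ultimately show ?thesis by (simp add: sgn_mult)
qed

lemma sgn_pderiv_simple_zeros:
  assumes "simple_zeros f d r" "i < d"
  shows "sgn (poly (pderiv f) (r i)) = sgn (lead_coeff f) * (-1) ^ i"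
proof -
  let ?J = "{..<d} - {i}"
  define h where "h = smult (lead_coeff f) (\<Prod>j\<in>?J. [:- r j, 1:])"
  have "(\<Prod>j<d. [:- r j, 1:]) = [:- r i, 1:] * (\<Prod>j\<in>?J. [:- r j, 1:])"
    using assms(2) by (intro prod.remove) auto
  then have "f = [:- r i, 1:] * h"
    using simple_zeros_product[OF assms(1)] by (metis h_def mult_smult_right)
  then have "pderiv f = pderiv ([:- r i, 1:] * h)" by (rule arg_cong)
  then have "poly (pderiv f) (r i) = poly h (r i)"
    by (simp add: pderiv_mult pderiv_pCons del: mult_pCons_left)
  also have "\<dots> = lead_coeff f * (\<Prod>j\<in>?J. r i - r j)"
    by (simp add: h_def poly_prod)
  also have "sgn \<dots> = sgn (lead_coeff f) * (-1) ^ card {j \<in> ?J. r i < r j}"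
    using assms unfolding sgn_mult
    by (subst sgn_prod_diff) (auto simp: simple_zeros_def, metis less_irrefl linorder_neqE_nat)
  also have "{j \<in> ?J. r i < r j} = {..<i}"
    using assms by (auto simp: simple_zeros_def) (metis less_asym linorder_neqE_nat)
  finally show ?thesis by simp
qed

lemma real_rooted_simple_zeros:
  assumes "real_rooted f" "f \<noteq> 0" and simple: "\<And>x. poly f x = 0 \<Longrightarrow> poly (pderiv f) x \<noteq> 0"
  shows "simple_zeros f (degree f) (\<lambda>i. zeros f ! i)"
proof -
  have mset: "mset (zeros f) = proots f" by (simp add: zeros_def)
  have len: "length (zeros f) = degree f" by (rule length_zeros[OF assms(1)])
  have "rsquarefree f" using simple by (auto simp: rsquarefree_roots)
  then have "count (mset (zeros f)) x \<le> 1" for x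
    unfolding mset using assms(2) by (auto simp: rsquarefree_def) (metis le0 order_refl)
  then have "distinct (zeros f)"
    by (metis count_mset_0_iff distinct_count_atmost_1 le_antisym less_one not_le count_greater_eq_one_iff in_multiset_in_set)
  moreover have "sorted (rev (zeros f))" by (simp add: zeros_def)
  ultimately have "zeros f ! j < zeros f ! i" if "i < j" "j < degree f" for i j
    using that len sorted_rev_nth_mono[of "zeros f" i j]
    by (auto simp: less_le nth_eq_iff_index_eq)
  moreover have "poly f (zeros f ! i) = 0" if "i < degree f" for i
  proof -
    have "zeros f ! i \<in># proots f" using that len by (metis mset nth_mem set_mset_mset)
    then show ?thesis using assms(2) by simp
  qed
  ultimately show ?thesis using assms(2) by (simp add: simple_zeros_def)
qed

text \<open>The intermediate value theorem gives a zero in each open interval; the intervals run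
  from right to left to match the decreasing order.\<close>

lemma simple_zeros_of_sign_changes:
  assumes "f \<noteq> 0" "degree f \<le> d"
    and less: "\<And>i. i < d \<Longrightarrow> l i < u i" and next_le: "\<And>i. Suc i < d \<Longrightarrow> u (Suc i) \<le> l i"
    and change: "\<And>i. i < d \<Longrightarrow> poly f (l i) * poly f (u i) < 0"
  obtains r where "simple_zeros f d r" "\<And>i. i < d \<Longrightarrow> l i < r i" "\<And>i. i < d \<Longrightarrow> r i < u i"
proof -
  have "\<exists>x. i < d \<longrightarrow> l i < x \<and> x < u i \<and> poly f x = 0" for i
    using poly_IVT[of "l i" "u i" f] less change by blast
  then obtain r where r: "\<And>i. i < d \<Longrightarrow> l i < r i \<and> r i < u i \<and> poly f (r i) = 0"
    by metis
  have step: "r (Suc i) < r i" if "Suc i < d" for i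
    using r[of i] r[of "Suc i"] next_le[of i] that by simp
  have "r j < r i" if "i < j" "j < d" for i j
    using that
  proof (induction j)
    case (Suc j)
    then show ?case using step[of j] by (cases "i = j") auto
  qed simp
  then have "simple_zeros f d r" using assms(1,2) r by (simp add: simple_zeros_def)
  then show thesis using r that by blast
qed

lemma sgn_poly_at_bot:
  fixes f :: "real poly"
  assumes "f \<noteq> 0"
  obtains L where "\<And>x. x \<le> L \<Longrightarrow> sgn (poly f x) = sgn (lead_coeff f) * (-1) ^ degree f"
proof -
  define c where "c = lead_coeff f * (-1) ^ degree f"
  \<comment> \<open>Reflecting the variable and scaling by \<open>c\<close> makes the leading
    coefficient \<open>c * c\<close>, so the behaviour at plus infinity applies.\<close>
  define g where "g = smult c (pcompose f [:0, -1:])"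
  have "lead_coeff (pcompose f [:0, -1:]) = c"
    by (simp add: c_def lead_coeff_comp)
  moreover have c: "c \<noteq> 0" using assms by (simp add: c_def)
  ultimately have "lead_coeff g = c * c" unfolding g_def by (simp only: lead_coeff_smult)
  then have "lead_coeff g > 0" using c by (metis not_real_square_gt_zero)
  then obtain M where M: "\<And>x. x \<ge> M \<Longrightarrow> poly g x > 0"
    using poly_pinfty_gt_lc by (metis order_less_le_trans)
  have "sgn (poly f x) = sgn c" if "x \<le> - M" for x
  proof -
    have "c * poly f x > 0" using M[of "- x"] that by (simp add: g_def poly_pcompose)
    then show ?thesis by (auto simp: zero_less_mult_iff sgn_if)
  qed
  moreover have "sgn c = sgn (lead_coeff f) * (-1) ^ degree f"
    by (cases "even (degree f)") (simp_all add: c_def)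
  ultimately show thesis using that[of "- M"] by simp
qed

lemma neg_if_sgn: "sgn x = s \<Longrightarrow> sgn y = - s \<Longrightarrow> s \<noteq> 0 \<Longrightarrow> x * y < (0::real)"
  by (auto simp: sgn_if mult_less_0_iff split: if_splits)

text \<open>At a zero of \<open>p\<close> the Wronskian is \<open>p' q > 0\<close>. So the zero is
  simple and \<open>q\<close> has the sign of \<open>p'\<close> there, which alternates along the
  zeros.\<close>

lemma interlacing_zeros_of_Wronskian:
  assumes "degree p = n" "degree q = n" "lead_coeff p > 0" "lead_coeff q > 0" "real_rooted p"
    and W: "\<And>x. poly (pderiv p) x * poly q x - poly p x * poly (pderiv q) x > 0"
  obtains r s where "simple_zeros p n r" "simple_zeros q n s"
    "\<And>i. i < n \<Longrightarrow> s i < r i" "\<And>i. Suc i < n \<Longrightarrow> r (Suc i) < s i"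
proof -
  define r where "r = (\<lambda>i. zeros p ! i)"
  have nz: "p \<noteq> 0" "q \<noteq> 0" using assms by auto
  have r: "simple_zeros p n r"
    unfolding r_def assms(1)[symmetric]
  proof (rule real_rooted_simple_zeros)
    show "poly (pderiv p) x \<noteq> 0" if "poly p x = 0" for x
      using W[of x] that by auto
  qed (use assms(5) nz in auto)
  have q_r: "sgn (poly q (r i)) = (-1) ^ i" if "i < n" for i
  proof -
    have "poly p (r i) = 0" using r that by (simp add: simple_zeros_def)
    then have "poly (pderiv p) (r i) * poly q (r i) > 0" using W[of "r i"] by simp
    then have "sgn (poly q (r i)) = sgn (poly (pderiv p) (r i))"
      by (auto simp: zero_less_mult_iff)
    then show ?thesis using sgn_pderiv_simple_zeros[OF r that] assms(3) by simp
  qed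
  obtain L where L: "\<And>x. x \<le> L \<Longrightarrow> sgn (poly q x) = (-1) ^ n"
    using sgn_poly_at_bot[OF nz(2)] assms(2,4) by (metis mult_1 sgn_pos)
  \<comment> \<open>The point with index \<open>n\<close> lies left of all zeros of
    \<open>p\<close>, where \<open>q\<close> already has its sign at minus infinity; it yields the
    last zero of \<open>q\<close>.\<close>
  define u where "u i = (if i < n then r i else min L (r (n - 1) - 1))" for i
  have sgn_u: "sgn (poly q (u i)) = (-1) ^ i" if "i \<le> n" for i
    using that q_r L by (cases "i = n") (auto simp: u_def)
  obtain s where s: "simple_zeros q n s" "\<And>i. i < n \<Longrightarrow> u (Suc i) < s i" "\<And>i. i < n \<Longrightarrow> s i < u i"
  proof (rule simple_zeros_of_sign_changes[of q n "\<lambda>i. u (Suc i)" u])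
    show "u (Suc i) < u i" if "i < n" for i
    proof (cases "Suc i < n")
      case True
      then show ?thesis using r by (auto simp: u_def simple_zeros_def)
    next
      case False
      then have "i = n - 1" using that by simp
      then show ?thesis using that by (auto simp: u_def min_def)
    qed
    show "poly q (u (Suc i)) * poly q (u i) < 0" if "i < n" for i
      by (rule neg_if_sgn[OF sgn_u]) (use that sgn_u[of i] in auto)
  qed (use nz assms(2) in auto)
  have "s i < r i" if "i < n" for i using s(3)[OF that] that by (simp add: u_def)
  moreover have "r (Suc i) < s i" if "Suc i < n" for i using s(2)[of i] that by (simp add: u_def)
  ultimately show thesis using that r s(1) by blast
qed

lemma preceq_of_simple_zeros:
  assumes "simple_zeros f n r" "simple_zeros g m s" "n = m \<or> n = Suc m"
    and "\<And>i. i < m \<Longrightarrow> s i \<le> r i" "\<And>i. Suc i < n \<Longrightarrow> r (Suc i) \<le> s i"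
  shows "g \<preceq> f"
  using assms unfolding preceq_poly_def Let_def
  by (auto simp: simple_zeros_degree simple_zeros_real_rooted simple_zeros_zeros simp del: upt_Suc)

text \<open>This serves the case \<open>k = n + 1\<close>, where the polynomial equals its
  reversal.\<close>

lemma preceq_refl:
  assumes "real_rooted f"
  shows "f \<preceq> f"
  using assms length_zeros[OF assms] unfolding preceq_poly_def Let_def
  by (auto intro!: sorted_rev_nth_mono simp: zeros_def)

lemma simple_zeros_lead_coeff_pos:
  assumes "simple_zeros f d r" "\<And>i. i < d \<Longrightarrow> r i < x" "poly f x > 0"
  shows "lead_coeff f > 0"
  using sgn_poly_simple_zeros[OF assms(1), of 0 x] assms(2,3) by (simp add: sgn_if split: if_splits)

text \<open>
  With \<open>q = a + b\<close> and \<open>p = a + x b\<close> we have \<open>(x - 1) a = x q - p\<close> and \<open>(x - 1) b = p - q\<close>.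
  Hence the signs of \<open>a\<close> and \<open>b\<close> at the zeros of \<open>p\<close> and \<open>q\<close> are known, which places
  the zeros of \<open>a\<close> in \<open>(s\<^sub>i, r\<^sub>i)\<close> and those of \<open>b\<close> in \<open>(r\<^bsub>i+1\<^esub>, s\<^sub>i)\<close>.
\<close>

lemma interlaces_of_decomposition:
  assumes r: "simple_zeros p n r" and s: "simple_zeros q n s"
    and sr: "\<And>i. i < n \<Longrightarrow> s i < r i" and rs: "\<And>i. Suc i < n \<Longrightarrow> r (Suc i) < s i"
    and lc: "lead_coeff p > 0" "lead_coeff q > 0"
    and neg: "\<And>i. i < n \<Longrightarrow> r i < 0" and n: "n \<ge> 1"
    and p: "p = a + pCons 0 b" and q: "q = a + b"
    and deg: "degree a \<le> n" "degree b \<le> n - 1"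
  shows "b \<lless> a"
proof -
  have s_neg: "s i < 0" if "i < n" for i using sr[OF that] neg[OF that] by simp
  have r_anti: "r j < r i" if "i < j" "j < n" for i j using r that by (auto simp: simple_zeros_def)
  have s_anti: "s j < s i" if "i < j" "j < n" for i j using s that by (auto simp: simple_zeros_def)
  have q_r: "sgn (poly q (r i)) = (-1) ^ i" if "i < n" for i
  proof -
    have "s j < r i" if "i \<le> j" "j < n" for j
      using sr[of i] s_anti[of i j] that by (cases "i = j") auto
    moreover have "r i < s j" if "j < i" for j
      using rs[of j] r_anti[of "Suc j" i] that \<open>i < n\<close> by (cases "i = Suc j") auto
    ultimately show ?thesis using sgn_poly_simple_zeros[OF s, of i "r i"] that lc by simp
  qed
  \<comment> \<open>The zeros of \<open>p\<close> to the right of \<open>s i\<close> are those with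
    index at most \<open>i\<close>, one more than in \<open>q_r\<close>.\<close>
  have p_s: "sgn (poly p (s i)) = - ((-1) ^ i)" if "i < n" for i
  proof -
    have "r j < s i" if "Suc i \<le> j" "j < n" for j
      using rs[of i] r_anti[of "Suc i" j] that by (cases "j = Suc i") auto
    moreover have "s i < r j" if "j < Suc i" for j
      using sr[of i] r_anti[of j i] that \<open>i < n\<close> by (cases "i = j") auto
    ultimately show ?thesis using sgn_poly_simple_zeros[OF r, of "Suc i" "s i"] that lc by simp
  qed
  \<comment> \<open>At a zero \<open>r\<close> of \<open>p\<close>, \<open>a = - r b\<close> and
    \<open>q = (1 - r) b\<close>; both factors are positive as \<open>r < 0\<close>.\<close>
  have a_r: "sgn (poly a (r i)) = (-1) ^ i" and b_r: "sgn (poly b (r i)) = (-1) ^ i" if "i < n" for i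
  proof -
    have "poly a (r i) + r i * poly b (r i) = 0"
      using r that by (simp add: simple_zeros_def p)
    then have *: "poly a (r i) = - r i * poly b (r i)" by simp
    then have "poly q (r i) = (1 - r i) * poly b (r i)" by (simp add: q algebra_simps)
    then show "sgn (poly b (r i)) = (-1) ^ i"
      using q_r[OF that] neg[OF that] by (simp add: sgn_mult)
    then show "sgn (poly a (r i)) = (-1) ^ i"
      using neg[OF that] unfolding * by (simp add: sgn_mult)
  qed
  \<comment> \<open>At a zero \<open>s\<close> of \<open>q\<close>, \<open>a = - b\<close> and
    \<open>p = - (1 - s) b\<close>.\<close>
  have a_s: "sgn (poly a (s i)) = - ((-1) ^ i)" and b_s: "sgn (poly b (s i)) = (-1) ^ i" if "i < n" for i
  proof -
    have "poly a (s i) + poly b (s i) = 0"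
      using s that by (simp add: simple_zeros_def q)
    then have *: "poly a (s i) = - poly b (s i)" by simp
    then have "poly p (s i) = - (1 - s i) * poly b (s i)" by (simp add: p algebra_simps)
    then have "sgn (poly p (s i)) = - sgn (poly b (s i))"
      using s_neg[OF that] by (simp only: sgn_mult) simp
    then show "sgn (poly b (s i)) = (-1) ^ i"
      using p_s[OF that] by simp
    then show "sgn (poly a (s i)) = - ((-1) ^ i)"
      unfolding * by (simp add: sgn_minus)
  qed
  have nz: "a \<noteq> 0" "b \<noteq> 0" using a_r[of 0] b_r[of 0] n by auto
  obtain t where t: "simple_zeros a n t" "\<And>i. i < n \<Longrightarrow> s i < t i" "\<And>i. i < n \<Longrightarrow> t i < r i"
  proof (rule simple_zeros_of_sign_changes[OF nz(1) deg(1), of s r])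
    show "poly a (s i) * poly a (r i) < 0" if "i < n" for i
      by (rule neg_if_sgn[OF a_s]) (use that a_r[of i] in auto)
  qed (use sr rs in \<open>auto intro: less_imp_le\<close>)
  obtain v where v: "simple_zeros b (n - 1) v"
    "\<And>i. i < n - 1 \<Longrightarrow> r (Suc i) < v i" "\<And>i. i < n - 1 \<Longrightarrow> v i < s i"
  proof (rule simple_zeros_of_sign_changes[OF nz(2) deg(2), of "\<lambda>i. r (Suc i)" s])
    show "poly b (r (Suc i)) * poly b (s i) < 0" if "i < n - 1" for i
      by (rule neg_if_sgn[OF b_r]) (use that b_s[of i] in auto)
  qed (use sr rs in \<open>auto intro: less_imp_le\<close>)
  have "b \<preceq> a"
  proof (rule preceq_of_simple_zeros[OF t(1) v(1)])
    show "v i \<le> t i" if "i < n - 1" for i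
      using v(3)[OF that] t(2)[of i] that by linarith
    show "t (Suc i) \<le> v i" if "Suc i < n" for i
      using v(2)[of i] t(3)[of "Suc i"] that by linarith
  qed (use n in auto)
  \<comment> \<open>The sign is read off at \<open>r 0\<close>, which lies to the right of all zeros
    of \<open>a\<close>; for \<open>b\<close> the point \<open>s 0\<close> does the same.\<close>
  moreover have "lead_coeff a > 0"
  proof (rule simple_zeros_lead_coeff_pos[OF t(1)])
    show "t i < r 0" if "i < n" for i
      using t(3)[OF that] r_anti[of 0 i] that by (cases "i = 0") auto
    show "poly a (r 0) > 0" using a_r[of 0] n by (simp add: sgn_1_pos)
  qed
  moreover have "lead_coeff b > 0"
  proof (rule simple_zeros_lead_coeff_pos[OF v(1)])
    show "v i < s 0" if "i < n - 1" for i
      using v(3)[OF that] s_anti[of 0 i] that by (cases "i = 0") fastforce+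
    show "poly b (s 0) > 0" using b_s[of 0] n by (simp add: sgn_1_pos)
  qed
  ultimately show ?thesis by (simp add: interlaces_def)
qed

section \<open>Interlacing for the ascent polynomial and its decomposition\<close>

lemma poly_ascent_poly_pos:
  assumes "k > n" "x \<ge> 0"
  shows "poly (ascent_poly n k) x > 0"
proof -
  have "1 = coeff (ascent_poly n k) 0 * x ^ 0" using coeff_ascent_poly_0[OF assms(1)] by simp
  also have "\<dots> \<le> (\<Sum>i\<le>degree (ascent_poly n k). coeff (ascent_poly n k) i * x ^ i)"
    using assms coeff_ascent_poly_nonneg
    by (intro member_le_sum) (auto intro!: mult_nonneg_nonneg)
  finally show ?thesis by (simp add: poly_altdef)
qed

theorem proposition5p5:
  fixes n k :: nat and a b :: "real poly"
  assumes "n \<ge> 1" and "k \<ge> 1"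
    and "recip_decomposition n (ascent_poly n k) a b"
    and "k > n"
  shows "degree (ascent_poly n k) = n \<and>
         recip n (ascent_poly n k) \<lless> ascent_poly n k \<and>
         alternatingly_increasing (ascent_poly n k) \<and>
         b \<lless> a"
proof -
  define p where "p = ascent_poly n k"
  define q where "q = recip n p"
  have p: "p = a + pCons 0 b" and deg: "degree a \<le> n" "degree b \<le> n - 1"
    and ra: "recip n a = a" and rb: "recip (n - 1) b = b"
    using assms(3) by (simp_all add: recip_decomposition_def p_def)
  have "recip n (pCons 0 b) = b"
    using recip_X_mult[OF deg(2) assms(1)] rb by simp
  then have q: "q = a + b"
    unfolding q_def using ra by (subst p) (simp only: recip_add)
  have degp: "degree p = n" unfolding p_def by (rule degree_ascent_poly[OF assms(4)])
  have alt: "alternatingly_increasing p"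
    unfolding p_def by (rule alternatingly_increasing_ascent_poly[OF assms(4)])
  have rr: "real_rooted p" unfolding p_def using assms by (intro real_rooted_ascent_poly) simp
  have lcp: "lead_coeff p > 0"
    using coeff_ascent_poly_nonneg[OF assms(4), of n] assms(1) degp
    by (metis degree_0 leading_coeff_0_iff less_le not_one_le_zero p_def)
  have q_from: "q = ascent_poly_from k n (k - n - 1)"
    unfolding q_def p_def by (rule recip_ascent_poly[OF assms(4)])
  have "q \<lless> p \<and> b \<lless> a"
  proof (cases "k = Suc n")
    \<comment> \<open>Now the residue \<open>k - n - 1\<close> is 0, so \<open>q = p\<close> and
      \<open>(x - 1) b = 0\<close>; the convention for the zero polynomial gives the second
      claim.\<close>
    case True
    then have "q = p" using q_from by (simp add: p_def ascent_poly_eq_from)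
    then have "pCons 0 b = [:1:] * b" using p q by simp
    then have "[:-1, 1:] * b = 0" by simp
    then have "b = 0" by (metis mult_eq_0_iff one_neq_zero pCons_eq_0_iff)
    then show ?thesis using preceq_refl[OF rr] rr \<open>q = p\<close> p by (simp add: interlaces_def)
  next
    case False
    have q_n: "coeff q n = 1"
      using coeff_ascent_poly_0[OF assms(4)] by (simp add: q_def coeff_recip p_def)
    have degq: "degree q = n"
    proof (rule antisym)
      show "degree q \<le> n" by (rule degree_le) (simp add: q_def coeff_recip)
      show "n \<le> degree q" using q_n by (intro le_degree) simp
    qed
    have lcq: "lead_coeff q > 0" using q_n degq by simp
    \<comment> \<open>Since \<open>k > n + 1\<close>, the starting letters 0 and
      \<open>k - n - 1\<close> are distinct, and \<open>n \<ge> 1\<close> makes the form strictly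
      positive.\<close>
    have W: "poly (pderiv p) x * poly q x - poly p x * poly (pderiv q) x > 0" for x
      unfolding q_from p_def ascent_poly_eq_from
      using False assms
      by (intro interlacing_form.ascent_poly_from_pos[OF interlacing_form_Wronskian]) auto
    obtain r s where rs: "simple_zeros p n r" "simple_zeros q n s"
      "\<And>i. i < n \<Longrightarrow> s i < r i" "\<And>i. Suc i < n \<Longrightarrow> r (Suc i) < s i"
      using interlacing_zeros_of_Wronskian[OF degp degq lcp lcq rr W] by blast
    have "r i < 0" if "i < n" for i
      using poly_ascent_poly_pos[OF assms(4), of "r i"] rs(1) that
      by (auto simp: simple_zeros_def p_def not_le[symmetric])
    then have "b \<lless> a"
      using rs lcp lcq assms(1) p q deg by (intro interlaces_of_decomposition[of p n r q s])
    moreover have "q \<preceq> p"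
      using rs by (intro preceq_of_simple_zeros[OF rs(1,2)]) (auto intro: less_imp_le)
    ultimately show ?thesis using lcp lcq by (simp add: interlaces_def)
  qed
  then show ?thesis using degp alt by (simp add: p_def q_def)
qed

end
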